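(* Let $V_3\subset\mathbb{F}_3^4$ be a $3$-dimensional subspace such that the plane $\mathbb{P}V_3\subset\operatorname{PG}(3,3)$ contains exactly two of the four points $\langle1000\rangle,\langle0100\rangle,\langle0010\rangle,\langle0001\rangle$ (kind $\mathcal{C}_2$), let $H=\{A_\lambda:\lambda\in V_3\}$, and let $\mathcal{R}$ be any one of $\mathcal{R}_H,\mathcal{R}'_H,\mathcal{R}''_H$. Then the span $\langle\mathcal{R}\rangle$ is a $5$-dimensional projective subspace ($5$-flat) of $\operatorname{PG}(7,2)$.
   Context: Work over $\mathbb{F}_2$. $V_8=V(8,2)$ with basis $e_1,\dots,e_8$, $V_a=\langle e_1,e_8\rangle$, $V_b=\langle e_2,e_7\rangle$, $V_c=\langle e_3,e_6\rangle$, $V_d=\langle e_4,e_5\rangle$; points of $\operatorname{PG}(7,2)$ are nonzero vectors; $\omega_4$ is the set of vectors all four of whose components in $V_a,\dots,V_d$ are nonzero. Let $\zeta_a: e_1\mapsto e_8\mapsto e_1+e_8\mapsto e_1$, $\zeta_b: e_7\mapsto e_2\mapsto e_2+e_7\mapsto e_7$, $\zeta_c: e_3\mapsto e_6\mapsto e_3+e_6\mapsto e_3$, $\zeta_d: e_5\mapsto e_4\mapsto e_4+e_5\mapsto e_5$. For $\lambda=ijkl\in\mathbb{F}_3^4$ let $A_\lambda=\zeta_a^i\oplus\zeta_b^j\oplus\zeta_c^k\oplus\zeta_d^l$; these form a group $\mathcal{G}_{81}\cong(Z_3)^4$. Let $u=e_1+\dots+e_8$. For a subgroup $H\cong(Z_3)^3$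 of $\mathcal{G}_{81}$ with cosets $H,H',H''$, set $\mathcal{R}_H=\{hu:h\in H\}$, $\mathcal{R}'_H=\{hu:h\in H'\}$, $\mathcal{R}''_H=\{hu:h\in H''\}$ (27-subsets of $\omega_4$). *)

theory Defs
  imports
    "HOL-Analysis.Analysis"
    "HOL-Library.Z2"
    "HOL-Algebra.Coset"
    "Berlekamp_Zassenhaus.Finite_Field"
begin

text \<open>
  \<open>F_2\<close> is \<^typ>\<open>bit\<close>. \<open>F_3\<close> is the ring of integers modulo the cardinality of a
  three-element type; \<^typ>\<open>Enum.finite_3\<close> only serves to supply that cardinality.
\<close>

lemma CARD_finite_3: "CARD(Enum.finite_3) = 3"
  by (simp add: UNIV_finite_3)

instance Enum.finite_3 :: prime_card
proof
  show "prime CARD(Enum.finite_3)"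
    unfolding CARD_finite_3 by simp
qed

type_synonym gf3 = "Enum.finite_3 mod_ring"

text \<open>The index type \<open>8\<close> is the type of integers modulo 8, so that the index \<open>8\<close> is \<open>0\<close>;
  likewise for the index \<open>4\<close> of type \<open>4\<close>.\<close>

type_synonym V8 = "bit ^ 8"

definition e :: "8 \<Rightarrow> V8" where
  "e i = axis i 1"

definition u :: V8 where
  "u = (\<Sum>i\<in>UNIV. e i)"


text \<open>
  \<open>zeta p q\<close> is the linear map \<open>e_p \<mapsto> e_q \<mapsto> e_p + e_q \<mapsto> e_p\<close> of the plane spanned by
  \<open>e_p\<close> and \<open>e_q\<close>. To have a function on all of \<open>V8\<close>, it is extended by zero on the other basis
  vectors; it is only ever applied (and iterated) on that plane, onto which \<open>block p q\<close> projects.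
\<close>

definition block :: "8 \<Rightarrow> 8 \<Rightarrow> V8 \<Rightarrow> V8" where
  "block p q x = x $ p *s e p + x $ q *s e q"

definition zeta :: "8 \<Rightarrow> 8 \<Rightarrow> V8 \<Rightarrow> V8" where
  "zeta p q x = x $ p *s e q + x $ q *s (e p + e q)"

definition zeta_a :: "V8 \<Rightarrow> V8" where "zeta_a = zeta 1 8"
definition zeta_b :: "V8 \<Rightarrow> V8" where "zeta_b = zeta 7 2"
definition zeta_c :: "V8 \<Rightarrow> V8" where "zeta_c = zeta 3 6"
definition zeta_d :: "V8 \<Rightarrow> V8" where "zeta_d = zeta 5 4"

text \<open>The representative of an exponent modulo 3 in \<open>{0, 1, 2}\<close>.\<close>

definition expo :: "gf3 \<Rightarrow> nat" where
  "expo i = nat (to_int_mod_ring i)"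

definition A :: "gf3 ^ 4 \<Rightarrow> V8 \<Rightarrow> V8" where
  "A l x = (zeta_a ^^ expo (l $ 1)) (block 1 8 x) + (zeta_b ^^ expo (l $ 2)) (block 2 7 x)
         + (zeta_c ^^ expo (l $ 3)) (block 3 6 x) + (zeta_d ^^ expo (l $ 4)) (block 4 5 x)"

definition G81 :: "(V8 \<Rightarrow> V8) monoid" where
  "G81 = \<lparr>carrier = range A, mult = (\<circ>), one = id\<rparr>"


text \<open>The points of \<open>PG(3,3)\<close> are the one-dimensional subspaces of \<open>F_3^4\<close>.\<close>

definition points_of :: "(gf3 ^ 4) set \<Rightarrow> (gf3 ^ 4) set set" where
  "points_of V = {P. vec.subspace P \<and> vec.dim P = 1 \<and> P \<subseteq> V}"

definition coord_points :: "(gf3 ^ 4) set set" where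
  "coord_points = {vec.span {axis i 1} | i. True}"

definition kind_C :: "nat \<Rightarrow> (gf3 ^ 4) set \<Rightarrow> bool" where
  "kind_C r V \<longleftrightarrow> card (points_of V \<inter> coord_points) = r"


text \<open>The points of \<open>PG(7,2)\<close> are the nonzero vectors of \<open>V8\<close>; dimensions of flats are projective.\<close>

definition is_flat :: "nat \<Rightarrow> V8 set \<Rightarrow> bool" where
  "is_flat k F \<longleftrightarrow> (\<exists>W. vec.subspace W \<and> vec.dim W = k + 1 \<and> F = W - {0})"

definition flat_span :: "V8 set \<Rightarrow> V8 set" where
  "flat_span S = vec.span S - {0}"


lemma zeta_a: "zeta_a (e 1) = e 8" "zeta_a (e 8) = e 1 + e 8" "zeta_a (e 1 + e 8) = e 1"
  and zeta_b: "zeta_b (e 7) = e 2" "zeta_b (e 2) = e 2 + e 7" "zeta_b (e 2 + e 7) = e 7"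
  and zeta_c: "zeta_c (e 3) = e 6" "zeta_c (e 6) = e 3 + e 6" "zeta_c (e 3 + e 6) = e 3"
  and zeta_d: "zeta_d (e 5) = e 4" "zeta_d (e 4) = e 4 + e 5" "zeta_d (e 4 + e 5) = e 5"
  by (simp_all add: zeta_a_def zeta_b_def zeta_c_def zeta_d_def zeta_def e_def vec_eq_iff axis_def)

lemma expo_add: "expo (i + j) = (expo i + expo j) mod 3"
proof -
  have "to_int_mod_ring i \<ge> 0" "to_int_mod_ring j \<ge> 0"
    using range_to_int_mod_ring[where 'a = Enum.finite_3] by auto
  then show ?thesis
    by (simp add: CARD_finite_3 expo_def to_int_mod_ring_add nat_mod_distrib nat_add_distrib)
qed

lemma zeta_nth:
  "p \<noteq> q \<Longrightarrow> zeta p q x $ r = (if r = p then x $ q else if r = q then x $ p + x $ q else 0)"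
  by (simp add: zeta_def e_def axis_def)

lemma block_nth:
  "p \<noteq> q \<Longrightarrow> block p q x $ r = (if r = p \<or> r = q then x $ r else 0)"
  by (auto simp add: block_def e_def axis_def)

lemma block_commute: "block p q = block q p"
  by (simp add: block_def fun_eq_iff add.commute)

lemma block_add: "block p q (x + y) = block p q x + block p q y"
  by (simp add: block_def vec.scale_left_distrib del: add_bit_eq_xor)

lemma zeta_pow_nth_other:
  assumes "p \<noteq> q" "r \<noteq> p" "r \<noteq> q"
  shows "(zeta p q ^^ n) (block p q x) $ r = 0"
  using assms by (cases n) (simp_all add: zeta_nth block_nth)

lemma block_zeta_pow:
  assumes "p \<noteq> q"
  shows "block p q ((zeta p q ^^ n) (block p q x)) = (zeta p q ^^ n) (block p q x)"
  using assms by (simp add: vec_eq_iff block_nth zeta_pow_nth_other)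

lemma block_zeta_pow_other:
  assumes "p \<noteq> q" "{p, q} \<inter> {r, s} = {}"
  shows "block r s ((zeta p q ^^ n) (block p q x)) = 0"
  using assms by (simp add: block_def[of r s] zeta_pow_nth_other)

lemma zeta_pow_3:
  assumes "p \<noteq> q"
  shows "(zeta p q ^^ 3) (block p q x) = block p q x"
  using assms
  by (cases "x $ p"; cases "x $ q") (simp_all add: vec_eq_iff numeral_3_eq_3 zeta_nth block_nth)

lemma zeta_pow_add_expo:
  assumes "p \<noteq> q"
  shows "(zeta p q ^^ expo (i + j)) (block p q x)
    = (zeta p q ^^ expo i) ((zeta p q ^^ expo j) (block p q x))"
  using funpow_mod_eq[OF zeta_pow_3[OF assms], of "expo i + expo j" x]
  by (simp add: expo_add funpow_add)

lemma A_eq: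
  "A l x = (zeta 1 8 ^^ expo (l $ 1)) (block 1 8 x) + (zeta 7 2 ^^ expo (l $ 2)) (block 7 2 x)
         + (zeta 3 6 ^^ expo (l $ 3)) (block 3 6 x) + (zeta 5 4 ^^ expo (l $ 4)) (block 5 4 x)"
  by (simp add: A_def zeta_a_def zeta_b_def zeta_c_def zeta_d_def block_commute[of 2 7]
      block_commute[of 4 5])

lemma A_add: "A (l + m) = A l \<circ> A m"
proof
  fix x
  show "A (l + m) x = (A l \<circ> A m) x"
    by (simp add: A_eq[of "l + m"] A_eq[of l] A_eq[of m] block_add block_zeta_pow
        block_zeta_pow_other zeta_pow_add_expo)
qed

lemma UNIV_8: "(UNIV :: 8 set) = {1, 2, 3, 4, 5, 6, 7, 8}"
proof -
  have "card {1, 2, 3, 4, 5, 6, 7, 8 :: 8} = CARD(8)"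
    by simp
  then show ?thesis
    by (metis card_subset_eq finite top_greatest)
qed

lemma A_0: "A 0 = id"
proof
  fix x
  have "\<forall>r\<in>{1, 2, 3, 4, 5, 6, 7, 8}. A 0 x $ r = x $ r"
    by (simp add: A_eq expo_def block_nth)
  then show "A 0 x = id x"
    by (simp add: vec_eq_iff flip: UNIV_8)
qed

lemma comm_group_G81: "comm_group G81"
proof (rule comm_groupI)
  fix g assume "g \<in> carrier G81"
  then obtain l where "g = A l"
    by (auto simp: G81_def)
  then have "A (- l) \<in> carrier G81" "A (- l) \<otimes>\<^bsub>G81\<^esub> g = \<one>\<^bsub>G81\<^esub>"
    by (simp_all add: G81_def A_0 flip: A_add)
  then show "\<exists>h\<in>carrier G81. h \<otimes>\<^bsub>G81\<^esub> g = \<one>\<^bsub>G81\<^esub>"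
    by blast
next
  show "\<one>\<^bsub>G81\<^esub> \<in> carrier G81"
    by (simp add: G81_def flip: A_0)
qed (auto simp: G81_def ac_simps simp flip: A_add)

lemma subgroup_A_image:
  assumes "vec.subspace V"
  shows "subgroup (A ` V) G81"
proof -
  interpret G: comm_group G81
    by (rule comm_group_G81)
  show ?thesis
  proof (rule G.subgroupI)
    fix g assume "g \<in> A ` V"
    then obtain l where l: "l \<in> V" "g = A l"
      by blast
    have "inv\<^bsub>G81\<^esub> g = A (- l)"
      by (rule G.inv_equality) (simp_all add: G81_def l A_0 flip: A_add)
    then show "inv\<^bsub>G81\<^esub> g \<in> A ` V"
      using l assms vec.subspace_neg by blast
  next
    fix g h assume "g \<in> A ` V" "h \<in> A ` V"
    then show "g \<otimes>\<^bsub>G81\<^esub> h \<in> A ` V"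
      using assms by (auto simp: G81_def vec.subspace_add simp flip: A_add)
  next
    show "A ` V \<noteq> {}"
      using assms vec.subspace_0 by blast
  qed (auto simp: G81_def)
qed

lemma zeta_pow_u:
  assumes "p \<noteq> q" "(zeta p q ^^ expo i) (block p q u) $ p = 1"
    "(zeta p q ^^ expo i) (block p q u) $ q = 1"
  shows "i = 0"
proof -
  have u: "u $ r = 1" for r
    by (simp add: u_def e_def axis_def)
  have "expo i < 3"
    using expo_add[of i 0] by (simp add: expo_def)
  then have "expo i = 0 \<or> expo i = 1 \<or> expo i = 2"
    by linarith
  then have "expo i = 0"
    using assms by (auto simp: zeta_nth block_nth u numeral_2_eq_2)
  moreover have "to_int_mod_ring i \<ge> 0"
    using range_to_int_mod_ring[where 'a = Enum.finite_3] by auto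
  ultimately show ?thesis
    by (simp add: expo_def)
qed

lemma A_eq_id: "l = 0" if "A l = id"
proof -
  have u: "A l u $ r = 1" for r
    by (simp add: that u_def e_def axis_def)
  have "l $ 1 = 0"
    by (rule zeta_pow_u[of 1 8])
      (use u[of 1] u[of 8] in \<open>simp_all add: A_eq zeta_pow_nth_other\<close>)
  moreover have "l $ 2 = 0"
    by (rule zeta_pow_u[of 7 2])
      (use u[of 7] u[of 2] in \<open>simp_all add: A_eq zeta_pow_nth_other\<close>)
  moreover have "l $ 3 = 0"
    by (rule zeta_pow_u[of 3 6])
      (use u[of 3] u[of 6] in \<open>simp_all add: A_eq zeta_pow_nth_other\<close>)
  moreover have "l $ 4 = 0"
    by (rule zeta_pow_u[of 5 4])
      (use u[of 5] u[of 4] in \<open>simp_all add: A_eq zeta_pow_nth_other\<close>)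
  ultimately show ?thesis
    by (simp add: vec_eq_iff forall_4)
qed

lemma inj_A: "inj A"
proof (rule injI)
  fix l m assume "A l = A m"
  then have "A (- m + l) = id"
    unfolding A_add by (simp add: A_0 flip: A_add)
  then show "l = m"
    using A_eq_id by fastforce
qed

lemma order_G81: "order G81 = 81"
  by (simp add: order_def G81_def card_image inj_A CARD_finite_3)

lemma card_coord_points: "card coord_points = 4"
proof -
  have "inj (\<lambda>i::4. vec.span {axis i (1::gf3)})"
  proof (rule injI)
    fix i j :: 4
    assume "vec.span {axis i (1::gf3)} = vec.span {axis j 1}"
    then have "axis i (1::gf3) \<in> vec.span {axis j 1}"
      using vec.span_base by blast
    then obtain k where "axis i (1::gf3) = k *s axis j 1"
      by (auto simp: vec.span_singleton)
    then have "axis i (1::gf3) $ i = (k *s axis j 1) $ i"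
      by simp
    then show "i = j"
      by (auto simp: axis_def split: if_splits)
  qed
  then show ?thesis
    by (simp add: coord_points_def full_SetCompr_eq card_image)
qed

end

theory Submission
  imports Defs
begin

text \<open>
  If \<open>V3\<close> contains exactly the coordinate points \<open>i\<close> and \<open>j\<close>, then in the remaining coordinates it is
  the graph of a line \<open>x\<^sub>l = c x\<^sub>k\<close> with \<open>c \<noteq> 0\<close>, and its translates are given by
  \<open>x\<^sub>l = c x\<^sub>k + d\<close>. Hence \<open>R\<close> consists of all sums of a nonzero vector of the block \<open>i\<close>, a nonzero
  vector of the block \<open>j\<close> and one of three vectors \<open>f s\<close> of the sum of the blocks \<open>k\<close> and \<open>l\<close>. In each
  of the three summands the three possible values add up to zero, so each spans at most a plane;
  adding up three elements of \<open>R\<close> that differ in one summand only kills that summand, so the span of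
  \<open>R\<close> contains all of the summands. Its dimension is exactly \<open>6\<close>, since the block \<open>l\<close>, of dimension
  \<open>2\<close>, completes it to the whole space.
\<close>

lemma expo_simps: "expo 0 = 0" "expo 1 = 1" "expo 2 = 2"
  using expo_add[of 1 1] by (simp_all add: expo_def)

lemma gf3_distinct: "(1::gf3) \<noteq> 0" "(2::gf3) \<noteq> 0" "(2::gf3) \<noteq> 1"
  using expo_simps by force+

lemma UNIV_gf3: "(UNIV :: gf3 set) = {0, 1, 2}"
proof -
  have "card {0, 1, 2 :: gf3} = CARD(gf3)"
    using gf3_distinct by (simp add: CARD_finite_3)
  then show ?thesis
    by (metis card_subset_eq finite top_greatest)
qed

lemma sum_gf3: "sum f (UNIV :: gf3 set) = f 0 + f 1 + f 2"
  for f :: "gf3 \<Rightarrow> 'a::comm_monoid_add"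
  using gf3_distinct by (simp add: UNIV_gf3 add.assoc)

text \<open>For \<open>p \<noteq> q\<close> this labels the three nonzero vectors of a block by F_3,
  so that \<open>zeta p q\<close> adds 1 to the label.\<close>

definition zeta_orbit :: "8 \<Rightarrow> 8 \<Rightarrow> gf3 \<Rightarrow> V8" where
  "zeta_orbit p q s = (zeta p q ^^ expo s) (block p q u)"

lemma zeta_orbit_simps:
  assumes "p \<noteq> q"
  shows "zeta_orbit p q 0 = e p + e q" "zeta_orbit p q 1 = e p" "zeta_orbit p q 2 = e q"
proof -
  have u: "u $ r = 1" for r
    by (simp add: u_def e_def axis_def)
  show "zeta_orbit p q 0 = e p + e q" "zeta_orbit p q 1 = e p" "zeta_orbit p q 2 = e q"
    using assms
    by (auto simp: zeta_orbit_def expo_simps vec_eq_iff zeta_nth block_nth u numeral_2_eq_2 e_def axis_def)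
qed

text \<open>The two indices of each block, in the order in which \<open>zeta_a\<close>, \<dots>, \<open>zeta_d\<close> take them.\<close>

definition first_index :: "4 \<Rightarrow> 8" where
  "first_index b = (if b = 1 then 1 else if b = 2 then 7 else if b = 3 then 3 else 5)"

definition second_index :: "4 \<Rightarrow> 8" where
  "second_index b = (if b = 1 then 8 else if b = 2 then 2 else if b = 3 then 6 else 4)"

definition blockvec :: "4 \<Rightarrow> gf3 \<Rightarrow> V8" where
  "blockvec b = zeta_orbit (first_index b) (second_index b)"

lemma first_neq_second: "first_index b \<noteq> second_index b"
  by (simp add: first_index_def second_index_def)

lemma A_u_eq_sum: "A l u = (\<Sum>b\<in>UNIV. blockvec b (l $ b))"
  by (simp add: A_eq blockvec_def zeta_orbit_def first_index_def second_index_def sum_4)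

lemma V8_add_self: "(x::V8) + x = 0"
  by (simp add: vec_eq_iff)

lemma sum_blockvec: "(\<Sum>s\<in>UNIV. blockvec b s) = 0"
  by (simp only: sum_gf3 blockvec_def zeta_orbit_simps[OF first_neq_second]
      add.assoc[of "e _ + e _"] V8_add_self)

lemma span_blockvec: "vec.span (\<Union>b. range (blockvec b)) = UNIV"
proof -
  let ?S = "vec.span (\<Union>b. range (blockvec b))"
  have "blockvec b s \<in> ?S" for b s
    by (auto intro: vec.span_base)
  from this[of _ 1] this[of _ 2]
  have "e (first_index b) \<in> ?S" "e (second_index b) \<in> ?S" for b
    unfolding blockvec_def zeta_orbit_simps[OF first_neq_second] by blast+
  from this[of 1] this[of 2] this[of 3] this[of 4]
  have "e i \<in> ?S" for i
    using UNIV_I[of i] unfolding UNIV_8 by (auto simp: first_index_def second_index_def)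
  then have "x \<in> ?S" for x
    unfolding e_def by (subst basis_expansion[symmetric]) (auto intro: vec.span_sum vec.span_scale)
  then show ?thesis
    by blast
qed

lemma sum_zero_in_span:
  fixes f :: "gf3 \<Rightarrow> V8"
  assumes "sum f UNIV = 0"
  shows "f s \<in> vec.span {f 0, f 1}"
proof -
  have "f 2 = - (f 0 + f 1)"
    using assms by (simp add: sum_gf3 eq_neg_iff_add_eq_0 add.commute del: minus_add_distrib)
  moreover have "- (f 0 + f 1) \<in> vec.span {f 0, f 1}"
    by (intro vec.span_neg vec.span_add) (auto intro: vec.span_base)
  ultimately show ?thesis
    using UNIV_I[of s] unfolding UNIV_gf3 by (auto simp: vec.span_base)
qed

text \<open>Summing \<open>f s + y\<close> over the three \<open>s\<close> cancels the
  \<open>f s\<close> and leaves \<open>y + y + y = y\<close> in characteristic 2.\<close>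

lemma summands_in_span:
  fixes f :: "gf3 \<Rightarrow> V8"
  assumes "sum f UNIV = 0" "\<And>s. f s + y \<in> vec.span S"
  shows "f s \<in> vec.span S" "y \<in> vec.span S"
proof -
  have "(\<Sum>s\<in>UNIV. f s + y) = (\<Sum>s\<in>UNIV. f s) + (y + y) + y"
    by (simp only: sum_gf3 add_ac)
  then have "(\<Sum>s\<in>UNIV. f s + y) = y"
    using assms(1) by (simp only: V8_add_self) simp
  then show y: "y \<in> vec.span S"
    by (metis assms(2) vec.span_sum)
  show "f s \<in> vec.span S"
    using vec.span_diff[OF assms(2) y] by simp
qed

text \<open>A coordinate point lies in \<open>V\<close> iff its generator does, and distinct indices
  give distinct points, so indices can be counted instead.\<close>

lemma kind_C_iff: "kind_C r V \<longleftrightarrow> card {i. axis i 1 \<in> V} = r" if "vec.subspace V"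
proof -
  let ?P = "\<lambda>i::4. vec.span {axis i (1::gf3)}"
  have sub: "?P i \<subseteq> V \<longleftrightarrow> axis i 1 \<in> V" for i
    using that vec.span_minimal[of "{axis i 1}" V] vec.span_base[of "axis i 1" "{axis i 1}"] by auto
  have dim: "vec.dim (?P i) = 1" for i
    by (simp add: vec.dim_eq_card_independent axis_eq_0_iff)
  have "points_of V \<inter> coord_points = ?P ` {i. axis i 1 \<in> V}"
    by (auto simp: points_of_def coord_points_def dim simp flip: sub)
  moreover have "inj ?P"
    by (rule eq_card_imp_inj_on)
      (use card_coord_points in \<open>simp_all add: coord_points_def full_SetCompr_eq\<close>)
  ultimately show ?thesis
    by (simp add: kind_C_def card_image inj_on_subset)
qed

text \<open>The hyperplane \<open>V\<close> is the kernel of a linear form that vanishes at the two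
  axes in \<open>V\<close> and is nonzero at the other two.\<close>

lemma kind_C_2_graph:
  assumes V: "vec.subspace V" "vec.dim V = 3" "kind_C 2 V"
  obtains i j k l c where "distinct [i, j, k, l]" "UNIV = {i, j, k, l}" "c \<noteq> 0"
    "V = {x. x $ l = c * x $ k}"
proof -
  let ?J = "{i. axis i 1 \<in> V}"
  have "card ?J = 2"
    using V kind_C_iff by blast
  moreover from this have "card (- ?J) = 2"
    by (simp add: Compl_eq_Diff_UNIV card_Diff_subset)
  ultimately obtain i j k l where ij: "?J = {i, j}" "i \<noteq> j" and kl: "- ?J = {k, l}" "k \<noteq> l"
    by (meson card_2_iff)
  have dist: "distinct [i, j, k, l]" and all: "UNIV = {i, j, k, l}"
    using ij kl by auto
  have mem: "axis i 1 \<in> V" "axis j 1 \<in> V" and nmem: "axis k 1 \<notin> V" "axis l 1 \<notin> V"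
    using ij kl by auto
  have span: "vec.span V = V"
    using V(1) by simp
  \<comment> \<open>\<open>V\<close> and \<open>axis l 1\<close> together span everything, so
    \<open>axis k 1\<close> agrees modulo \<open>V\<close> with a multiple of
    \<open>axis l 1\<close>.\<close>
  have "vec.dim (insert (axis l 1) V) = 4"
    using nmem(2) V(2) by (simp add: vec.dim_insert span)
  then have "vec.span (insert (axis l 1) V) = UNIV"
    using vec.dim_eq_full[of "insert (axis l 1) V"] by (simp add: vec.dimension_def card_cart_basis)
  then obtain t where t: "axis k 1 - t *s axis l 1 \<in> V"
    using vec.span_breakdown_eq[of "axis k 1" "axis l 1" V] span by auto
  then have "t \<noteq> 0"
    using nmem(1) by auto
  \<comment> \<open>\<open>g x\<close> is the projection of \<open>x\<close> to \<open>V\<close>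
    along \<open>axis l 1\<close>; it can change only coordinate \<open>l\<close>.\<close>
  define g where "g x = x $ i *s axis i 1 + x $ j *s axis j 1
    + x $ k *s (axis k 1 - t *s axis l 1)" for x :: "gf3 ^ 4"
  have g: "g x \<in> V" for x
    unfolding g_def using V(1) mem t by (intro vec.subspace_add vec.subspace_scale)
  have decomp: "x = g x + (x $ l + t * x $ k) *s axis l 1" for x
  proof (subst vec_eq_iff, rule allI)
    fix r
    have "r \<in> {i, j, k, l}"
      using all by blast
    then show "x $ r = (g x + (x $ l + t * x $ k) *s axis l 1) $ r"
      using dist by (auto simp: g_def axis_def)
  qed
  have "x \<in> V \<longleftrightarrow> x $ l = - t * x $ k" for x
  proof
    assume "x \<in> V"
    then have "x - g x \<in> V"
      using V(1) g vec.subspace_diff by blast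
    then have "(x $ l + t * x $ k) *s axis l 1 \<in> V"
      using decomp[of x] by (metis add_diff_cancel_left')
    then have "x $ l + t * x $ k = 0"
      using nmem(2) V(1) vec.subspace_scale[OF V(1), of _ "inverse (x $ l + t * x $ k)"]
      by (metis left_inverse vec.scale_one vec.scale_scale)
    then show "x $ l = - t * x $ k"
      by (simp add: add_eq_0_iff2)
  next
    assume "x $ l = - t * x $ k"
    then show "x \<in> V"
      using decomp[of x] g[of x] by simp
  qed
  then show ?thesis
    using that[OF dist all, of "- t"] \<open>t \<noteq> 0\<close> by auto
qed

lemma dim_span_graph:
  assumes dist: "distinct [i, j, k, l]" and all: "UNIV = {i, j, k, l}" and "c \<noteq> 0"
  shows "vec.dim (vec.span {\<Sum>b\<in>UNIV. blockvec b (y $ b) | y. y $ l = c * y $ k + d}) = 6"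
    (is "vec.dim (vec.span ?R) = 6")
proof -
  define f where "f s = blockvec k s + blockvec l (c * s + d)" for s
  \<comment> \<open>An affine map of nonzero slope permutes F_3, so the block \<open>l\<close> part
    of \<open>f\<close> sums to zero whatever the offset \<open>d\<close>.\<close>
  have "bij (\<lambda>s. c * s + d)"
    by (rule bij_betw_byWitness[where f' = "\<lambda>s. (s - d) / c"]) (use \<open>c \<noteq> 0\<close> in auto)
  then have "(\<Sum>s\<in>UNIV. blockvec l (c * s + d)) = 0"
    using sum.reindex_bij_betw[of "\<lambda>s. c * s + d" UNIV UNIV "blockvec l"] sum_blockvec by simp
  then have sum_f: "sum f UNIV = 0"
    by (simp add: f_def sum.distrib sum_blockvec)
  have sum_eq: "(\<Sum>b\<in>UNIV. blockvec b (y $ b))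
      = blockvec i (y $ i) + (blockvec j (y $ j) + f (y $ k))"
    if "y $ l = c * y $ k + d" for y
    using dist that by (simp add: all f_def)
  have R_mem: "blockvec i a + (blockvec j b + f s) \<in> vec.span ?R" for a b s
  proof -
    define y where "y = (\<chi> r. if r = i then a else if r = j then b else if r = k then s else c * s + d)"
    have "blockvec i a + (blockvec j b + f s) = (\<Sum>b\<in>UNIV. blockvec b (y $ b))"
      "y $ l = c * y $ k + d"
      using sum_eq[of y] dist by (auto simp: y_def)
    then show ?thesis
      by (auto intro: vec.span_base)
  qed
  \<comment> \<open>Block \<open>i\<close> is split off first, then block \<open>j\<close> from the
    remainder, which leaves \<open>f s\<close> itself in the span.\<close>
  note wi = summands_in_span[OF sum_blockvec R_mem]
  note wj = summands_in_span[OF sum_blockvec wi(2)]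
  let ?B = "{blockvec i 0, blockvec i 1, blockvec j 0, blockvec j 1, f 0, f 1}"
  have mono: "vec.span {blockvec i 0, blockvec i 1} \<subseteq> vec.span ?B"
    "vec.span {blockvec j 0, blockvec j 1} \<subseteq> vec.span ?B" "vec.span {f 0, f 1} \<subseteq> vec.span ?B"
    by (intro vec.span_mono; blast)+
  then have in_B: "blockvec i s \<in> vec.span ?B" "blockvec j s \<in> vec.span ?B" "f s \<in> vec.span ?B" for s
    using sum_zero_in_span[OF sum_blockvec, of i s] sum_zero_in_span[OF sum_blockvec, of j s]
      sum_zero_in_span[OF sum_f, of s] by auto
  have span_eq: "vec.span ?R = vec.span ?B"
  proof (rule vec.span_eq[THEN iffD2], rule conjI)
    show "?R \<subseteq> vec.span ?B"
      using sum_eq in_B by (auto intro!: vec.span_add)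
    show "?B \<subseteq> vec.span ?R"
      using wi(1) wj by blast
  qed
  let ?T = "insert (blockvec l 0) (insert (blockvec l 1) ?B)"
  have sub: "vec.span ?B \<subseteq> vec.span ?T" "vec.span {blockvec l 0, blockvec l 1} \<subseteq> vec.span ?T"
    by (intro vec.span_mono; blast)+
  have wl: "blockvec l s \<in> vec.span ?T" for s
    using sum_zero_in_span[OF sum_blockvec] sub by blast
  \<comment> \<open>Block \<open>k\<close> is recovered from \<open>f s\<close> by subtracting its
    block \<open>l\<close> part.\<close>
  have wk: "blockvec k s \<in> vec.span ?T" for s
    using vec.span_diff[OF subsetD[OF sub(1) in_B(3)[of s]] wl[of "c * s + d"]] by (simp add: f_def)
  have "blockvec b s \<in> vec.span ?T" for b s
    using all wl wk in_B sub(1) by (cases "b = i"; cases "b = j"; cases "b = k") auto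
  then have "vec.span (\<Union>b. range (blockvec b)) \<subseteq> vec.span ?T"
    by (intro vec.span_minimal) auto
  then have "vec.dim ?T = 8"
    unfolding span_blockvec using vec.dim_eq_full[of ?T]
    by (simp add: vec.dimension_def card_cart_basis top.extremum_unique)
  \<comment> \<open>Each of the two insertions raises the dimension by at most 1.\<close>
  then have "8 \<le> vec.dim ?B + 2"
    by (simp add: vec.dim_insert split: if_splits)
  moreover have "vec.dim ?B \<le> 6"
    by (rule order_trans[OF vec.dim_le_card[OF vec.span_superset]]) (simp_all add: card_insert_le_m1)
  ultimately show ?thesis
    by (simp add: span_eq)
qed

theorem theorem7:
  fixes V3 :: "(gf3 ^ 4) set"
    and H :: "(V8 \<Rightarrow> V8) set"
    and C :: "(V8 \<Rightarrow> V8) set"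
    and R :: "V8 set"
  assumes "vec.subspace V3"
    and "vec.dim V3 = 3"
    and "kind_C 2 V3"
    and "H = {A l | l. l \<in> V3}"
    and "C \<in> rcosets\<^bsub>G81\<^esub> H"
    and "R = {h u | h. h \<in> C}"
  shows "is_flat 5 (flat_span R)"
proof -
  obtain i j k l c where ijkl: "distinct [i, j, k, l]" "UNIV = {i, j, k, l}" "c \<noteq> 0"
    and V3: "V3 = {x. x $ l = c * x $ k}"
    using kind_C_2_graph assms(1-3) by blast
  obtain m where "C = H #>\<^bsub>G81\<^esub> A m"
    using assms(5) by (auto simp: RCOSETS_def G81_def)
  then have "C = {A (x + m) | x. x \<in> V3}"
    by (auto simp: assms(4) r_coset_def G81_def A_add)
  then have R: "R = {A (x + m) u | x. x \<in> V3}"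
    using assms(6) by auto
  \<comment> \<open>Translation by \<open>m\<close> keeps the slope \<open>c\<close> and only
    changes the intercept, so all cosets are treated alike.\<close>
  define d where "d = m $ l - c * m $ k"
  have shift: "y - m \<in> V3 \<longleftrightarrow> y $ l = c * y $ k + d" for y
    by (auto simp: V3 d_def algebra_simps)
  have "R = {A y u | y. y - m \<in> V3}"
    unfolding R by (metis (no_types, opaque_lifting) add_diff_cancel diff_add_cancel)
  then have "R = {\<Sum>b\<in>UNIV. blockvec b (y $ b) | y. y $ l = c * y $ k + d}"
    by (simp add: A_u_eq_sum shift)
  then have "vec.dim (vec.span R) = 6"
    using dim_span_graph[OF ijkl] by blast
  then show ?thesis
    unfolding is_flat_def flat_span_def by (intro exI[of _ "vec.span R"]) simp
qed

end
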